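(* Let $q\ge 5$ be a fixed odd integer. For positive integers $n$, the number $M_{\rm CPB}(n,q)$ of sequences of length $n$ over ${\cal A}_q$ that are both charge-balanced and polarity-balanced satisfies $$M_{\rm CPB}(n,q)\approx q^n\,\frac{1}{\pi n}\sqrt{\frac{12q^2}{(q^2-1)(q-1)(q-3)}},$$ where $\approx$ means that the ratio of the two sides tends to $1$ as $n\to\infty$.
   Context: For an integer $q\ge 2$, ${\cal A}_q=\{-q+1,-q+3,-q+5,\ldots,q-3,q-1\}$ (a set of $q$ integers, containing $0$ when $q$ is odd). A sequence ${\bf x}=(x_1,\ldots,x_n)\in({\cal A}_q)^n$ is charge-balanced (CB) if $\sum_{i=1}^n x_i=0$, polarity-balanced (PB) if $|\{i:x_i>0\}|=|\{i:x_i<0\}|$, and charge and polarity balanced (CPB) if it is both CB and PB. $M_{\rm CPB}(n,q)$ is the number of CPB sequences in $({\cal A}_q)^n$. *)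

theory Defs
  imports "HOL-Analysis.Analysis" "HOL-Library.Landau_Symbols"
begin

definition alphabet :: "nat \<Rightarrow> int set" where
  "alphabet q = {- int q + 1 + 2 * int k | k. k < q}"

definition charge_balanced :: "int list \<Rightarrow> bool" where
  "charge_balanced xs \<longleftrightarrow> (\<Sum>i<length xs. xs ! i) = 0"

definition polarity_balanced :: "int list \<Rightarrow> bool" where
  "polarity_balanced xs \<longleftrightarrow>
     card {i. i < length xs \<and> xs ! i > 0} = card {i. i < length xs \<and> xs ! i < 0}"

definition CPB :: "int list \<Rightarrow> bool" where
  "CPB xs \<longleftrightarrow> charge_balanced xs \<and> polarity_balanced xs"

definition M_CPB :: "nat \<Rightarrow> nat \<Rightarrow> nat" where
  "M_CPB n q = card {xs. length xs = n \<and> set xs \<subseteq> alphabet q \<and> CPB xs}"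

end

theory Submission
  imports Defs "HOL-Probability.Distributions" "HOL-Real_Asymp.Real_Asymp"
begin

text \<open>
  The theorem is a two-dimensional local limit theorem. Write \<open>q = 2m + 1\<close>; for a uniform letter \<open>x\<close> the pair
  \<open>(x/2, sgn x)\<close> has the characteristic function
  \<open>\<phi>(s, t) = (1 + 2 \<Sum>k=1..m. cos (k s + t)) / q\<close>, which is real because the alphabet is symmetric.
  Fourier inversion gives \<open>M = q\<^sup>n / (4 \<pi>\<^sup>2) \<integral> \<phi>\<^sup>n\<close> over the square \<open>[-\<pi>, \<pi>]\<^sup>2\<close>.
  After rescaling by \<open>\<surd>n\<close> the integrand tends to a Gaussian, whose covariance determinant yields the constant.
  Domination comes from the two terms \<open>cos (s + t)\<close> and \<open>cos (2 s + t)\<close> alone (here \<open>m \<ge> 2\<close> is needed):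
  \<open>(1, 1)\<close> and \<open>(2, 1)\<close> generate the whole lattice, so \<open>\<bar>\<phi>\<bar> = 1\<close> only at the origin of the square.
\<close>

section \<open>Integration over the plane: products, dilations, Gaussians\<close>

lemma
  fixes f g :: "real \<Rightarrow> real"
  assumes f: "integrable lborel f" and g: "integrable lborel g"
  shows integrable_lborel_mult_prod: "integrable lborel (\<lambda>z. f (fst z) * g (snd z))"
    and integral_lborel_mult_prod:
      "(\<integral>z. f (fst z) * g (snd z) \<partial>lborel) = (\<integral>x. f x \<partial>lborel) * (\<integral>y. g y \<partial>lborel)"
proof -
  have int: "integrable (lborel \<Otimes>\<^sub>M lborel) (\<lambda>z. f (fst z) * g (snd z))"
    using f g by (intro lborel_pair.Fubini_integrable) (auto simp: abs_mult)
  then show "integrable lborel (\<lambda>z. f (fst z) * g (snd z))"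
    by (simp add: lborel_prod)
  have "(\<integral>z. f (fst z) * g (snd z) \<partial>(lborel \<Otimes>\<^sub>M lborel)) = (\<integral>x. (\<integral>y. f x * g y \<partial>lborel) \<partial>lborel)"
    using lborel_pair.integral_fst'[OF int] by simp
  then show "(\<integral>z. f (fst z) * g (snd z) \<partial>lborel) = (\<integral>x. f x \<partial>lborel) * (\<integral>y. g y \<partial>lborel)"
    by (simp add: lborel_prod)
qed

text \<open>The factor \<open>r\<^sup>2\<close> is the Jacobian of a dilation of the plane. With
  \<open>r = 1 / sqrt n\<close> it supplies the \<open>1 / n\<close> of the asymptotics.\<close>

lemma integral_lborel_scale2:
  fixes G :: "real \<times> real \<Rightarrow> real" and r :: real
  assumes "r > 0" and [measurable]: "G \<in> borel_measurable borel"
  shows "(\<integral>z. G z \<partial>lborel) = r\<^sup>2 * (\<integral>z. G (r *\<^sub>R z) \<partial>lborel)"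
  using assms(1)
  by (subst lborel_affine[of r 0])
     (simp_all add: integral_density integral_distr power2_eq_square)

lemma has_bochner_integral_gaussian:
  fixes a b :: real
  assumes "a > 0"
  shows "has_bochner_integral lborel (\<lambda>v. exp (- a * (v - b)\<^sup>2 / 2)) (sqrt (2 * pi / a))"
proof -
  define \<sigma> where "\<sigma> = 1 / sqrt a"
  have \<sigma>: "\<sigma> > 0" "\<sigma>\<^sup>2 = 1 / a"
    using assms by (auto simp: \<sigma>_def power_divide)
  have "has_bochner_integral lborel (\<lambda>v. sqrt (2 * pi / a) * normal_density b \<sigma> v) (sqrt (2 * pi / a) * 1)"
    using \<sigma>(1) by (intro has_bochner_integral_mult_right)
      (simp add: has_bochner_integral_iff)
  also have "(\<lambda>v. sqrt (2 * pi / a) * normal_density b \<sigma> v) = (\<lambda>v. exp (- a * (v - b)\<^sup>2 / 2))"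
    using assms by (auto simp: normal_density_def \<sigma>(2) fun_eq_iff)
  finally show ?thesis by simp
qed

text \<open>Completing the square in the second variable leaves \<open>\<delta> u\<^sup>2\<close> in
  the first, where \<open>\<delta>\<close> is the determinant divided by \<open>\<gamma>\<close>.
  The inner Gaussian is merely shifted by an amount depending on \<open>u\<close>, so its integral
  does not depend on the shift. Positivity of \<open>f\<close> lets the iterated integral also prove
  integrability.\<close>

lemma
  fixes \<alpha> \<beta> \<gamma> :: real
  assumes "\<gamma> > 0" and "\<alpha> * \<gamma> - \<beta>\<^sup>2 > 0"
  defines "f \<equiv> \<lambda>z. exp (- (\<alpha> * (fst z)\<^sup>2 + 2 * \<beta> * fst z * snd z + \<gamma> * (snd z)\<^sup>2) / 2)"
  shows integrable_gaussian2: "integrable lborel f"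
    and integral_gaussian2: "(\<integral>z. f z \<partial>lborel) = 2 * pi / sqrt (\<alpha> * \<gamma> - \<beta>\<^sup>2)"
proof -
  define \<delta> where "\<delta> = (\<alpha> * \<gamma> - \<beta>\<^sup>2) / \<gamma>"
  have "\<delta> > 0" using assms by (simp add: \<delta>_def)
  have f_eq: "f (u, v) = exp (- \<delta> * (u - 0)\<^sup>2 / 2) * exp (- \<gamma> * (v - (- \<beta> * u / \<gamma>))\<^sup>2 / 2)" for u v
    using assms(1) unfolding f_def \<delta>_def exp_add[symmetric]
    by (auto simp: field_simps power2_eq_square)
  have inner: "has_bochner_integral lborel (\<lambda>v. f (u, v))
      (exp (- \<delta> * (u - 0)\<^sup>2 / 2) * sqrt (2 * pi / \<gamma>))" for u
    unfolding f_eq by (intro has_bochner_integral_mult_right has_bochner_integral_gaussian assms(1))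
  have inner_int: "(\<integral>v. f (u, v) \<partial>lborel) = exp (- \<delta> * (u - 0)\<^sup>2 / 2) * sqrt (2 * pi / \<gamma>)" for u
    using inner by (simp add: has_bochner_integral_iff)
  have outer: "has_bochner_integral lborel (\<lambda>u. exp (- \<delta> * (u - 0)\<^sup>2 / 2) * sqrt (2 * pi / \<gamma>))
      (sqrt (2 * pi / \<delta>) * sqrt (2 * pi / \<gamma>))"
    by (intro has_bochner_integral_mult_left has_bochner_integral_gaussian \<open>\<delta> > 0\<close>)
  have abs_f: "norm (f z) = f z" for z by (simp add: f_def)
  have [measurable]: "f \<in> borel_measurable (lborel \<Otimes>\<^sub>M lborel)"
    unfolding f_def by measurable
  have int: "integrable (lborel \<Otimes>\<^sub>M lborel) f"
  proof (rule lborel_pair.Fubini_integrable)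
    show "integrable lborel (\<lambda>x. LINT y|lborel. norm (f (x, y)))"
      unfolding abs_f inner_int using outer by (simp only: has_bochner_integral_iff)
    show "AE x in lborel. integrable lborel (\<lambda>y. f (x, y))"
      using inner by (simp add: has_bochner_integral_iff)
  qed simp
  then show "integrable lborel f" by (simp add: lborel_prod)
  have "(\<integral>z. f z \<partial>lborel) = sqrt (2 * pi / \<delta>) * sqrt (2 * pi / \<gamma>)"
    using lborel_pair.integral_fst'[OF int] outer
    unfolding inner_int by (simp add: lborel_prod has_bochner_integral_iff)
  also have "\<dots> = sqrt ((2 * pi)\<^sup>2 / (\<alpha> * \<gamma> - \<beta>\<^sup>2))"
    using assms(1) by (simp add: \<delta>_def real_sqrt_mult[symmetric] power2_eq_square)
  also have "\<dots> = 2 * pi / sqrt (\<alpha> * \<gamma> - \<beta>\<^sup>2)"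
    by (simp add: real_sqrt_divide real_sqrt_mult)
  finally show "(\<integral>z. f z \<partial>lborel) = 2 * pi / sqrt (\<alpha> * \<gamma> - \<beta>\<^sup>2)" .
qed

section \<open>Orthogonality of cosines over a full period square\<close>

definition square :: "(real \<times> real) set" where
  "square = {-pi..pi} \<times> {-pi..pi}"

lemma square_measurable [measurable]: "square \<in> sets borel"
  unfolding square_def by (intro borel_closed closed_Times) auto

lemma indicator_square: "indicator square z = (indicator {-pi..pi} (fst z) * indicator {-pi..pi} (snd z) :: real)"
  by (cases z) (auto simp: square_def indicator_def)

lemma
  fixes f :: "real \<Rightarrow> real"
  assumes "(f has_integral c) {-pi..pi}" and "continuous_on {-pi..pi} f"
  shows integrable_indicator_period: "integrable lborel (\<lambda>x. indicator {-pi..pi} x * f x)"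
    and integral_indicator_period: "(\<integral>x. indicator {-pi..pi} x * f x \<partial>lborel) = c"
proof -
  have "set_integrable lborel {-pi..pi} f"
    using assms(2) by (rule borel_integrable_atLeastAtMost')
  then show "integrable lborel (\<lambda>x. indicator {-pi..pi} x * f x)"
    and "(\<integral>x. indicator {-pi..pi} x * f x \<partial>lborel) = c"
    using set_borel_integral_eq_integral(2)[of "{-pi..pi}" f] integral_unique[OF assms(1)]
    by (simp_all add: set_integrable_def set_lebesgue_integral_def)
qed

text \<open>The addition formula turns the integrand into two products of one-variable functions.
  Every sine integral vanishes, and a cosine integral survives only at frequency 0. This is the
  filter that later selects the words with both sums equal to zero.\<close>

lemma
  fixes a b :: int
  shows integrable_cos_square: "integrable lborel (\<lambda>z. indicator square z * cos (of_int a * fst z + of_int b * snd z))"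
    and integral_cos_square:
      "(\<integral>z. indicator square z * cos (of_int a * fst z + of_int b * snd z) \<partial>lborel)
        = (if a = 0 \<and> b = 0 then 4 * pi\<^sup>2 else 0 :: real)"
proof -
  let ?I = "indicator {-pi..pi} :: real \<Rightarrow> real"
  define C where "C = (\<lambda>n::int. \<lambda>x. ?I x * cos (of_int n * x))"
  define S where "S = (\<lambda>n::int. \<lambda>x. ?I x * sin (of_int n * x))"
  have C: "integrable lborel (C n)" "(\<integral>x. C n x \<partial>lborel) = (if n = 0 then 2 * pi else 0)" for n
  proof -
    have "continuous_on {-pi..pi} (\<lambda>x. cos (of_int n * x) :: real)"
      by (intro continuous_intros)
    note * = has_integral_cos_nx[of n] this
    show "integrable lborel (C n)" "(\<integral>x. C n x \<partial>lborel) = (if n = 0 then 2 * pi else 0)"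
      unfolding C_def using integrable_indicator_period[OF *] integral_indicator_period[OF *]
      by simp_all
  qed
  have S: "integrable lborel (S n)" "(\<integral>x. S n x \<partial>lborel) = 0" for n
  proof -
    have "continuous_on {-pi..pi} (\<lambda>x. sin (of_int n * x) :: real)"
      by (intro continuous_intros)
    note * = has_integral_sin_nx[of n] this
    show "integrable lborel (S n)" "(\<integral>x. S n x \<partial>lborel) = 0"
      unfolding S_def using integrable_indicator_period[OF *] integral_indicator_period[OF *]
      by simp_all
  qed
  have eq: "(\<lambda>z. indicator square z * cos (of_int a * fst z + of_int b * snd z))
      = (\<lambda>z. C a (fst z) * C b (snd z) - S a (fst z) * S b (snd z))"
    by (auto simp: C_def S_def indicator_square cos_add algebra_simps)
  have 1: "integrable lborel (\<lambda>z. C a (fst z) * C b (snd z))"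
      "integrable lborel (\<lambda>z. S a (fst z) * S b (snd z))"
    by (intro integrable_lborel_mult_prod C S)+
  then show "integrable lborel (\<lambda>z. indicator square z * cos (of_int a * fst z + of_int b * snd z))"
    unfolding eq by (rule Bochner_Integration.integrable_diff)
  show "(\<integral>z. indicator square z * cos (of_int a * fst z + of_int b * snd z) \<partial>lborel)
        = (if a = 0 \<and> b = 0 then 4 * pi\<^sup>2 else 0 :: real)"
    unfolding eq
    by (subst Bochner_Integration.integral_diff[OF 1])
       (simp add: integral_lborel_mult_prod C S power2_eq_square)
qed

section \<open>Sums over words and over the alphabet\<close>

text \<open>Real form of the multiplicativity of characteristic functions: the vanishing sine sum
  makes the one-letter sum of \<open>exp (i f x)\<close> real, so the phase \<open>u\<close> factors
  out as \<open>cos u\<close>. The phase is kept general because the induction absorbs the first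
  letter into it.\<close>

lemma sum_cos_lists:
  fixes f :: "'a \<Rightarrow> real"
  assumes "finite A" and sin0: "(\<Sum>x\<in>A. sin (f x)) = 0"
  shows "(\<Sum>xs | length xs = n \<and> set xs \<subseteq> A. cos (u + sum_list (map f xs))) = cos u * (\<Sum>x\<in>A. cos (f x)) ^ n"
proof (induction n arbitrary: u)
  case 0
  have "{xs::'a list. length xs = 0 \<and> set xs \<subseteq> A} = {[]}" by auto
  then show ?case by simp
next
  case (Suc n)
  let ?L = "\<lambda>n. {xs. length xs = n \<and> set xs \<subseteq> A}"
  have L: "?L (Suc n) = (\<lambda>(x, xs). x # xs) ` (A \<times> ?L n)"
    by (auto simp: length_Suc_conv image_iff)
  have "(\<Sum>xs\<in>?L (Suc n). cos (u + sum_list (map f xs)))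
      = (\<Sum>(x, xs)\<in>A \<times> ?L n. cos ((u + f x) + sum_list (map f xs)))"
    unfolding L by (subst sum.reindex) (auto simp: inj_on_def case_prod_unfold add.assoc)
  also have "\<dots> = (\<Sum>x\<in>A. \<Sum>xs\<in>?L n. cos ((u + f x) + sum_list (map f xs)))"
    by (rule sum.cartesian_product[symmetric])
  also have "\<dots> = (\<Sum>x\<in>A. cos (u + f x)) * (\<Sum>x\<in>A. cos (f x)) ^ n"
    by (simp add: Suc.IH sum_distrib_right)
  also have "(\<Sum>x\<in>A. cos (u + f x)) = cos u * (\<Sum>x\<in>A. cos (f x)) - sin u * (\<Sum>x\<in>A. sin (f x))"
    by (simp add: cos_add sum_subtractf sum_distrib_left)
  finally show ?case using sin0 by simp
qed

text \<open>Both sides are the even integers of absolute value at most \<open>2 m\<close>. Splitting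
  off 0 and the two signs allows the letters \<open>2 k\<close> and \<open>- 2 k\<close> to be
  paired.\<close>

lemma alphabet_odd:
  "alphabet (2 * m + 1) = {0} \<union> (\<lambda>k. 2 * int k) ` {1..m} \<union> (\<lambda>k. - 2 * int k) ` {1..m}"
proof -
  have "x \<in> alphabet (2 * m + 1) \<longleftrightarrow> even x \<and> \<bar>x\<bar> \<le> 2 * int m" for x
  proof
    assume "even x \<and> \<bar>x\<bar> \<le> 2 * int m"
    then have "x = - int (2 * m + 1) + 1 + 2 * int (nat (x div 2 + int m)) \<and> nat (x div 2 + int m) < 2 * m + 1"
      by auto
    then show "x \<in> alphabet (2 * m + 1)" unfolding alphabet_def by blast
  qed (auto simp: alphabet_def)
  moreover have "x \<in> {0} \<union> (\<lambda>k. 2 * int k) ` {1..m} \<union> (\<lambda>k. - 2 * int k) ` {1..m}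
      \<longleftrightarrow> even x \<and> \<bar>x\<bar> \<le> 2 * int m" for x
  proof
    assume *: "even x \<and> \<bar>x\<bar> \<le> 2 * int m"
    then have "x = 0 \<or> (x = 2 * int (nat (x div 2)) \<and> nat (x div 2) \<in> {1..m})
        \<or> (x = - 2 * int (nat (- x div 2)) \<and> nat (- x div 2) \<in> {1..m})"
      by auto
    then show "x \<in> {0} \<union> (\<lambda>k. 2 * int k) ` {1..m} \<union> (\<lambda>k. - 2 * int k) ` {1..m}" by blast
  qed auto
  ultimately show ?thesis by blast
qed

lemma finite_alphabet: "finite (alphabet q)"
  unfolding alphabet_def by simp

lemma sum_alphabet_odd:
  fixes f :: "int \<Rightarrow> real"
  shows "(\<Sum>x\<in>alphabet (2 * m + 1). f x) = f 0 + (\<Sum>k=1..m. f (2 * int k) + f (- 2 * int k))"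
proof -
  have "(\<Sum>x\<in>alphabet (2 * m + 1). f x)
      = f 0 + (\<Sum>x\<in>(\<lambda>k. 2 * int k) ` {1..m} \<union> (\<lambda>k. - 2 * int k) ` {1..m}. f x)"
    unfolding alphabet_odd Un_assoc by (subst sum.union_disjoint) auto
  also have "\<dots> = f 0 + ((\<Sum>x\<in>(\<lambda>k. 2 * int k) ` {1..m}. f x) + (\<Sum>x\<in>(\<lambda>k. - 2 * int k) ` {1..m}. f x))"
    by (subst sum.union_disjoint) auto
  finally show ?thesis by (simp add: sum.reindex inj_on_def sum.distrib)
qed

section \<open>Characteristic function and Fourier inversion\<close>

definition phi :: "nat \<Rightarrow> real \<times> real \<Rightarrow> real" where
  "phi m z = (1 + 2 * (\<Sum>k=1..m. cos (real k * fst z + snd z))) / (2 * real m + 1)"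

lemma phi_measurable [measurable]: "phi m \<in> borel_measurable borel"
  unfolding phi_def borel_prod[symmetric] by measurable

lemma charge_balanced_iff: "charge_balanced xs \<longleftrightarrow> sum_list xs = 0"
  by (simp add: charge_balanced_def sum_list_sum_nth atLeast0LessThan)

lemma polarity_balanced_iff: "polarity_balanced xs \<longleftrightarrow> sum_list (map sgn xs) = 0"
proof -
  have "sum_list (map sgn xs) = (\<Sum>i<length xs. of_bool (xs ! i > 0) - of_bool (xs ! i < 0))"
    by (auto simp: sum_list_sum_nth atLeast0LessThan sgn_if intro!: sum.cong)
  also have "\<dots> = int (card {i. i < length xs \<and> xs ! i > 0}) - int (card {i. i < length xs \<and> xs ! i < 0})"
    by (simp add: sum_subtractf of_bool_def sum.If_cases Int_def)
  finally show ?thesis by (auto simp: polarity_balanced_def)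
qed

text \<open>The cosines of the total phases of all words sum to \<open>q ^ n * phi m z ^ n\<close>.
  Integrating termwise over the square, each word with both sums zero contributes
  \<open>4 * pi\<^sup>2\<close> and every other word contributes 0.\<close>

lemma M_CPB_eq_integral:
  fixes m n :: nat
  defines "q \<equiv> 2 * m + 1"
  shows "4 * pi\<^sup>2 * real (M_CPB n q) = real q ^ n * (\<integral>z. indicator square z * phi m z ^ n \<partial>lborel)"
proof -
  let ?A = "alphabet q"
  let ?L = "{xs. length xs = n \<and> set xs \<subseteq> ?A}"
  \<comment> \<open>The charge is halved so that the frequencies are arbitrary integers up to
    \<open>m\<close> in absolute value, not only even ones; otherwise \<open>\<bar>phi\<bar>\<close>
    would attain 1 at further points of the square.\<close>
  let ?f = "\<lambda>z x. of_int (x div 2) * fst z + of_int (sgn x) * snd z :: real"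
  let ?a = "\<lambda>xs::int list. sum_list (map (\<lambda>x. x div 2) xs)" and ?b = "\<lambda>xs::int list. sum_list (map sgn xs)"
  have fin: "finite ?L"
    using finite_lists_length_eq[OF finite_alphabet[of q], of n] by (simp add: conj_commute)
  have theta: "sum_list (map (?f z) xs) = of_int (?a xs) * fst z + of_int (?b xs) * snd z" for z xs
    by (induction xs) (auto simp: algebra_simps)
  \<comment> \<open>\<open>div\<close> rounds down, so negation commutes with \<open>div 2\<close>
    only on even numbers. It does here, which gives the letters \<open>2 k\<close> and
    \<open>- 2 k\<close> opposite phases.\<close>
  have neg_even: "- (2 * int k) div 2 = - int k" for k
    by presburger
  have sin0: "(\<Sum>x\<in>?A. sin (?f z x)) = 0" for z
  proof -
    have "sin (?f z (2 * int k)) + sin (?f z (- 2 * int k)) = 0" if "k \<ge> 1" for k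
    proof -
      have "?f z (- 2 * int k) = - ?f z (2 * int k)" using that by (simp add: neg_even)
      then show ?thesis by (simp only: sin_minus)
    qed
    then show ?thesis unfolding q_def sum_alphabet_odd by (simp add: sum.neutral)
  qed
  have cosA: "(\<Sum>x\<in>?A. cos (?f z x)) = real q * phi m z" for z
  proof -
    have "cos (?f z (2 * int k)) + cos (?f z (- 2 * int k)) = 2 * cos (real k * fst z + snd z)" if "k \<ge> 1" for k
    proof -
      have "?f z (- 2 * int k) = - ?f z (2 * int k)" using that by (simp add: neg_even)
      then have "cos (?f z (2 * int k)) + cos (?f z (- 2 * int k)) = 2 * cos (?f z (2 * int k))"
        by (simp only: cos_minus)
      then show ?thesis using that by simp
    qed
    then have "(\<Sum>x\<in>?A. cos (?f z x)) = 1 + (\<Sum>k=1..m. 2 * cos (real k * fst z + snd z))"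
      unfolding q_def sum_alphabet_odd by simp
    moreover have "real q * (c / (2 * real m + 1)) = c" for c
      by (simp add: q_def add_eq_0_iff field_simps)
    ultimately show ?thesis by (simp add: phi_def sum_distrib_left)
  qed
  have CPB: "CPB xs \<longleftrightarrow> ?a xs = 0 \<and> ?b xs = 0" if "xs \<in> ?L" for xs
  proof -
    have "even x" if "x \<in> set xs" for x
      using \<open>xs \<in> ?L\<close> that unfolding q_def alphabet_odd by auto
    then have "sum_list xs = 2 * ?a xs"
      by (induction xs) auto
    then show ?thesis by (simp add: CPB_def charge_balanced_iff polarity_balanced_iff)
  qed
  have "real q ^ n * (\<integral>z. indicator square z * phi m z ^ n \<partial>lborel)
      = (\<integral>z. indicator square z * (\<Sum>xs\<in>?L. cos (0 + sum_list (map (?f z) xs))) \<partial>lborel)"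
    unfolding sum_cos_lists[OF finite_alphabet sin0] cosA
    by (simp add: power_mult_distrib mult_ac flip: integral_mult_right_zero)
  also have "\<dots> = (\<integral>z. (\<Sum>xs\<in>?L. indicator square z * cos (of_int (?a xs) * fst z + of_int (?b xs) * snd z)) \<partial>lborel)"
    unfolding theta by (simp add: sum_distrib_left)
  also have "\<dots> = (\<Sum>xs\<in>?L. if ?a xs = 0 \<and> ?b xs = 0 then 4 * pi\<^sup>2 else 0)"
    by (subst Bochner_Integration.integral_sum[OF integrable_cos_square])
       (rule sum.cong[OF refl integral_cos_square])
  also have "\<dots> = (\<Sum>xs\<in>?L. if CPB xs then 4 * pi\<^sup>2 else 0)"
    by (rule sum.cong) (use CPB in auto)
  also have "\<dots> = 4 * pi\<^sup>2 * real (card {xs\<in>?L. CPB xs})"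
    using fin by (simp add: sum.If_cases Int_def)
  finally show ?thesis by (simp add: M_CPB_def conj_assoc)
qed

section \<open>Gaussian domination of the characteristic function\<close>

text \<open>For \<open>y = \<bar>x\<bar> / 2\<close> the Taylor bound gives
  \<open>sin y \<ge> y - y ^ 3 / 6\<close>, and \<open>y \<le> pi / 2 < 2\<close> bounds
  \<open>y ^ 3\<close> by \<open>4 y\<close>, leaving \<open>y / 3\<close>. The constant is crude,
  but any positive one would serve.\<close>

lemma abs_sin_half_ge:
  fixes x :: real
  assumes "\<bar>x\<bar> \<le> pi"
  shows "\<bar>sin (x / 2)\<bar> \<ge> \<bar>x\<bar> / 6"
proof -
  have "sin y \<ge> y / 3" if "0 \<le> y" "y \<le> pi / 2" for y :: real
  proof -
    have "\<bar>sin y - y\<bar> \<le> y ^ 3 / 6"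
      using Maclaurin_sin_bound[of y 3] that
      by (simp add: numeral_eq_Suc sin_coeff_def)
    moreover have "y * y\<^sup>2 \<le> y * 4"
      using that pi_less_4 power_mono[of y 2 2] by (intro mult_left_mono) auto
    then have "y ^ 3 \<le> 4 * y" by (simp add: power3_eq_cube power2_eq_square)
    ultimately show ?thesis by linarith
  qed
  from this[of "\<bar>x\<bar> / 2"] show ?thesis
    using assms by (auto simp: abs_if split: if_splits)
qed

text \<open>All cosines with \<open>k \<ge> 3\<close> are bounded by 1; the decay comes from
  \<open>k = 1\<close> and \<open>k = 2\<close>. Since \<open>s\<close> and \<open>t\<close> are
  integer combinations of \<open>s + t\<close> and \<open>2 s + t\<close>, small \<open>A\<close>
  and \<open>B\<close> force \<open>s\<close> and \<open>t\<close> to be small. The constant 252 is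
  \<open>36 * 7\<close>: 36 from squaring the \<open>1 / 6\<close> of the sine bound, 7 from the
  quadratic form in \<open>A\<close> and \<open>B\<close>.\<close>

lemma abs_phi_le:
  assumes "m \<ge> 2" and "z \<in> square"
  shows "\<bar>phi m z\<bar> \<le> exp (- ((fst z)\<^sup>2 + (snd z)\<^sup>2) / (252 * (2 * real m + 1)))"
proof -
  obtain s t where z: "z = (s, t)" by (cases z)
  define A B where "A = sin ((s + t) / 2)" and "B = sin ((2 * s + t) / 2)"
  have cos_eq: "cos (s + t) = 1 - 2 * A\<^sup>2" "cos (2 * s + t) = 1 - 2 * B\<^sup>2"
  proof -
    have "2 * (x / 2) = x" for x :: real by simp
    then show "cos (s + t) = 1 - 2 * A\<^sup>2" "cos (2 * s + t) = 1 - 2 * B\<^sup>2"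
      unfolding A_def B_def by (metis cos_double_sin)+
  qed
  have le1: "A\<^sup>2 \<le> 1" "B\<^sup>2 \<le> 1"
    by (simp_all add: A_def B_def abs_square_le_1)
  have "\<bar>sin (s / 2)\<bar> \<le> \<bar>A\<bar> + \<bar>B\<bar>"
  proof -
    have "s / 2 = (2 * s + t) / 2 - (s + t) / 2" by (simp add: field_simps)
    then have "sin (s / 2) = B * cos ((s + t) / 2) - cos ((2 * s + t) / 2) * A"
      unfolding A_def B_def by (simp only: sin_diff)
    also have "\<bar>\<dots>\<bar> \<le> \<bar>B\<bar> * \<bar>cos ((s + t) / 2)\<bar> + \<bar>cos ((2 * s + t) / 2)\<bar> * \<bar>A\<bar>"
      unfolding abs_mult[symmetric] by (rule abs_triangle_ineq4)
    also have "\<dots> \<le> \<bar>B\<bar> * 1 + 1 * \<bar>A\<bar>"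
      by (intro add_mono mult_mono) auto
    finally show ?thesis by simp
  qed
  moreover have "\<bar>sin (t / 2)\<bar> \<le> \<bar>A\<bar> + \<bar>sin (s / 2)\<bar>"
  proof -
    have "t / 2 = (s + t) / 2 - s / 2" by (simp add: field_simps)
    then have "sin (t / 2) = A * cos (s / 2) - cos ((s + t) / 2) * sin (s / 2)"
      unfolding A_def by (simp only: sin_diff)
    also have "\<bar>\<dots>\<bar> \<le> \<bar>A\<bar> * \<bar>cos (s / 2)\<bar> + \<bar>cos ((s + t) / 2)\<bar> * \<bar>sin (s / 2)\<bar>"
      unfolding abs_mult[symmetric] by (rule abs_triangle_ineq4)
    also have "\<dots> \<le> \<bar>A\<bar> * 1 + 1 * \<bar>sin (s / 2)\<bar>"
      by (intro add_mono mult_mono) auto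
    finally show ?thesis by simp
  qed
  moreover have "\<bar>s\<bar> / 6 \<le> \<bar>sin (s / 2)\<bar>" "\<bar>t\<bar> / 6 \<le> \<bar>sin (t / 2)\<bar>"
    using assms(2) by (intro abs_sin_half_ge; auto simp: z square_def)+
  ultimately have "\<bar>s\<bar> / 6 \<le> \<bar>A\<bar> + \<bar>B\<bar>" "\<bar>t\<bar> / 6 \<le> 2 * \<bar>A\<bar> + \<bar>B\<bar>" by linarith+
  then have "(\<bar>s\<bar> / 6)\<^sup>2 + (\<bar>t\<bar> / 6)\<^sup>2 \<le> (\<bar>A\<bar> + \<bar>B\<bar>)\<^sup>2 + (2 * \<bar>A\<bar> + \<bar>B\<bar>)\<^sup>2"
    by (intro add_mono power_mono) auto
  \<comment> \<open>The form \<open>5 a\<^sup>2 + 6 a b + 2 b\<^sup>2\<close> is positive definite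
    with trace 7, so its larger eigenvalue is below 7.\<close>
  also have "\<dots> \<le> 7 * (A\<^sup>2 + B\<^sup>2)"
  proof -
    have "7 * (a\<^sup>2 + b\<^sup>2) - ((a + b)\<^sup>2 + (2 * a + b)\<^sup>2) = (2 * a - 3 * b)\<^sup>2 / 2 + b\<^sup>2 / 2" for a b :: real
      by (simp add: power2_eq_square field_simps)
    then have "0 \<le> 7 * (a\<^sup>2 + b\<^sup>2) - ((a + b)\<^sup>2 + (2 * a + b)\<^sup>2)" for a b :: real
      by simp
    from this[of "\<bar>A\<bar>" "\<bar>B\<bar>"] show ?thesis by simp
  qed
  finally have AB: "(s\<^sup>2 + t\<^sup>2) / 252 \<le> A\<^sup>2 + B\<^sup>2"
    by (simp add: power_divide)
  have "(\<Sum>k=1..m. cos (real k * s + t)) = cos (s + t) + cos (2 * s + t) + (\<Sum>k=3..m. cos (real k * s + t))"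
  proof -
    have "{1..m} = insert 1 (insert 2 {3..m})" using assms(1) by auto
    then show ?thesis by simp
  qed
  moreover have "\<bar>\<Sum>k=3..m. cos (real k * s + t)\<bar> \<le> (\<Sum>k=3..m. 1)"
    by (rule order_trans[OF sum_abs sum_mono]) auto
  moreover have "(\<Sum>k=3..m. 1) = real m - 2"
    using assms(1) by (simp add: of_nat_diff)
  \<comment> \<open>The lower bound has slack: \<open>1 + 2 cos (s + t) + 2 cos (2 s + t) \<ge> -3\<close>, while \<open>5 - (A\<^sup>2 + B\<^sup>2) \<ge> 3\<close>.\<close>
  ultimately have "\<bar>1 + 2 * (\<Sum>k=1..m. cos (real k * s + t))\<bar> \<le> (2 * real m + 1) - (A\<^sup>2 + B\<^sup>2)"
    using le1 zero_le_power2[of A] zero_le_power2[of B] unfolding cos_eq abs_le_iff by linarith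
  then have "\<bar>1 + 2 * (\<Sum>k=1..m. cos (real k * s + t))\<bar> \<le> (2 * real m + 1) - (s\<^sup>2 + t\<^sup>2) / 252"
    using AB by linarith
  then have "\<bar>phi m z\<bar> \<le> ((2 * real m + 1) - (s\<^sup>2 + t\<^sup>2) / 252) / (2 * real m + 1)"
    unfolding phi_def z abs_divide by (auto intro!: divide_right_mono)
  also have "\<dots> = 1 + - (s\<^sup>2 + t\<^sup>2) / (252 * (2 * real m + 1))"
    by (simp add: field_simps)
  also have "\<dots> \<le> exp (- (s\<^sup>2 + t\<^sup>2) / (252 * (2 * real m + 1)))"
    by (rule exp_ge_add_one_self)
  finally show ?thesis by (simp add: z)
qed

section \<open>Covariance form and pointwise limit\<close>

text \<open>The variance of \<open>(x/2) s + (sgn x) t\<close> for a uniform letter \<open>x\<close>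
  and \<open>z = (s, t)\<close>: the mean is 0, and the letters \<open>2 k\<close> and
  \<open>- 2 k\<close> contribute equal squares.\<close>

definition covar :: "nat \<Rightarrow> real \<times> real \<Rightarrow> real" where
  "covar m z = 2 * (\<Sum>k=1..m. (real k * fst z + snd z)\<^sup>2) / (2 * real m + 1)"

lemma covar_measurable [measurable]: "covar m \<in> borel_measurable borel"
  unfolding covar_def borel_prod[symmetric] by measurable

text \<open>Logarithms are avoided by comparing with \<open>exp (c / n) ^ n = exp c\<close>: for
  numbers of modulus at most 1, \<open>n\<close>-th powers differ by at most \<open>n\<close> times
  the difference of the bases. The sign of \<open>c\<close> keeps \<open>exp (c / n)\<close> within
  that range.\<close>

lemma tendsto_power_exp:
  fixes x :: "nat \<Rightarrow> real"
  assumes lim: "(\<lambda>n. real n * (x n - 1)) \<longlonglongrightarrow> c" and bound: "eventually (\<lambda>n. \<bar>x n\<bar> \<le> 1) sequentially"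
    and "c \<le> 0"
  shows "(\<lambda>n. x n ^ n) \<longlonglongrightarrow> exp c"
proof -
  have "(\<lambda>n. real n * (exp (c / real n) - 1)) \<longlonglongrightarrow> c"
    by real_asymp
  then have "(\<lambda>n. real n * (x n - 1) - real n * (exp (c / real n) - 1)) \<longlonglongrightarrow> c - c"
    by (intro tendsto_diff lim)
  then have "(\<lambda>n. \<bar>real n * (x n - exp (c / real n))\<bar>) \<longlonglongrightarrow> 0"
    by (simp add: algebra_simps tendsto_rabs_zero_iff)
  moreover have "eventually (\<lambda>n. norm (x n ^ n - exp c) \<le> \<bar>real n * (x n - exp (c / real n))\<bar>) sequentially"
    using bound eventually_gt_at_top[of 0]
  proof eventually_elim
    case (elim n)
    have "norm (x n ^ n - exp (c / real n) ^ n) \<le> real n * norm (x n - exp (c / real n))"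
      using elim \<open>c \<le> 0\<close> by (intro norm_power_diff) (auto simp: divide_nonpos_pos)
    also have "exp (c / real n) ^ n = exp c"
      using elim by (simp add: exp_of_nat_mult[symmetric])
    finally show ?case by (simp add: abs_mult)
  qed
  ultimately have "(\<lambda>n. x n ^ n - exp c) \<longlonglongrightarrow> 0"
    by (rule Lim_null_comparison[rotated])
  then show ?thesis by (simp add: LIM_zero_iff)
qed

text \<open>The expansion \<open>cos x - 1 ~ - x\<^sup>2 / 2\<close>, summed over \<open>k\<close>,
  gives \<open>n (phi - 1)\<close> the limit \<open>- covar / 2\<close>.\<close>

lemma phi_power_tendsto:
  "(\<lambda>n. phi m ((1 / sqrt (real n)) *\<^sub>R z) ^ n) \<longlonglongrightarrow> exp (- covar m z / 2)"
proof (rule tendsto_power_exp)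
  have *: "(\<lambda>n. real n * (cos (c / sqrt (real n)) - 1)) \<longlonglongrightarrow> - (c * c / 2)" for c :: real
    by real_asymp
  have "(\<lambda>n. 2 * (\<Sum>k=1..m. real n * (cos ((real k * fst z + snd z) / sqrt (real n)) - 1)) / (2 * real m + 1))
      \<longlonglongrightarrow> 2 * (\<Sum>k=1..m. - ((real k * fst z + snd z) * (real k * fst z + snd z) / 2)) / (2 * real m + 1)"
    by (intro tendsto_intros *) auto
  also have "2 * (\<Sum>k=1..m. - ((real k * fst z + snd z) * (real k * fst z + snd z) / 2)) / (2 * real m + 1) = - covar m z / 2"
  proof -
    have "(\<Sum>k=1..m. - ((real k * fst z + snd z) * (real k * fst z + snd z) / 2))
        = - ((\<Sum>k=1..m. (real k * fst z + snd z)\<^sup>2) / 2)"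
      by (simp only: sum_negf sum_divide_distrib power2_eq_square)
    moreover have "2 * (- (a / 2)) / b = - (2 * a / b) / 2" for a b :: real by simp
    ultimately show ?thesis by (simp only: covar_def)
  qed
  also have "(\<lambda>n. 2 * (\<Sum>k=1..m. real n * (cos ((real k * fst z + snd z) / sqrt (real n)) - 1)) / (2 * real m + 1))
      = (\<lambda>n. real n * (phi m ((1 / sqrt (real n)) *\<^sub>R z) - 1))"
  proof
    fix n
    let ?S = "\<Sum>k=1..m. cos ((real k * fst z + snd z) / sqrt (real n))"
    have "2 * (\<Sum>k=1..m. real n * (cos ((real k * fst z + snd z) / sqrt (real n)) - 1)) / (2 * real m + 1)
        = real n * ((2 * ?S - 2 * real m) / (2 * real m + 1))"
      by (simp add: sum_distrib_left[symmetric] sum_subtractf algebra_simps)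
    also have "(2 * ?S - 2 * real m) / (2 * real m + 1) = (1 + 2 * ?S) / (2 * real m + 1) - 1"
      by (simp add: divide_simps)
    also have "(1 + 2 * ?S) / (2 * real m + 1) = phi m ((1 / sqrt (real n)) *\<^sub>R z)"
      by (simp add: phi_def add_divide_distrib)
    finally show "2 * (\<Sum>k=1..m. real n * (cos ((real k * fst z + snd z) / sqrt (real n)) - 1)) / (2 * real m + 1)
        = real n * (phi m ((1 / sqrt (real n)) *\<^sub>R z) - 1)" .
  qed
  finally show "(\<lambda>n. real n * (phi m ((1 / sqrt (real n)) *\<^sub>R z) - 1)) \<longlonglongrightarrow> - covar m z / 2" .
  have "\<bar>phi m w\<bar> \<le> 1" for w
  proof -
    have "\<bar>\<Sum>k=1..m. cos (real k * fst w + snd w)\<bar> \<le> (\<Sum>k=1..m. 1)"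
      by (rule order_trans[OF sum_abs sum_mono]) auto
    then show ?thesis by (simp add: phi_def field_simps abs_le_iff)
  qed
  then show "eventually (\<lambda>n. \<bar>phi m ((1 / sqrt (real n)) *\<^sub>R z)\<bar> \<le> 1) sequentially" by simp
  show "- covar m z / 2 \<le> 0" by (simp add: covar_def sum_nonneg)
qed

text \<open>The coefficients are the variance of \<open>x/2\<close>, the covariance and the variance
  of \<open>sgn x\<close>. They come from the power sums of \<open>k\<close> and
  \<open>k\<^sup>2\<close> with \<open>4 m (m + 1) = q\<^sup>2 - 1\<close>.\<close>

lemma covar_eq:
  fixes m :: nat
  defines "q \<equiv> 2 * real m + 1"
  shows "covar m z = (q\<^sup>2 - 1) / 12 * (fst z)\<^sup>2 + 2 * ((q\<^sup>2 - 1) / (4 * q)) * fst z * snd z + (q - 1) / q * (snd z)\<^sup>2"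
proof -
  have 1: "(\<Sum>k=1..m. real k) = real m * (real m + 1) / 2"
    by (induction m) (auto simp: field_simps)
  have 2: "(\<Sum>k=1..m. (real k)\<^sup>2) = real m * (real m + 1) * (2 * real m + 1) / 6"
    by (induction m) (auto simp: field_simps power2_eq_square)
  have "q > 0" by (simp add: q_def)
  have "(\<Sum>k=1..m. (real k * fst z + snd z)\<^sup>2)
      = (fst z)\<^sup>2 * (\<Sum>k=1..m. (real k)\<^sup>2) + 2 * fst z * snd z * (\<Sum>k=1..m. real k) + real m * (snd z)\<^sup>2"
    by (simp add: power2_sum power_mult_distrib sum.distrib sum_distrib_left mult_ac)
  also have "\<dots> = (fst z)\<^sup>2 * ((q\<^sup>2 - 1) * q / 24) + 2 * fst z * snd z * ((q\<^sup>2 - 1) / 8) + (q - 1) / 2 * (snd z)\<^sup>2"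
    unfolding 1 2 by (simp add: q_def power2_eq_square field_simps)
  finally have sum_eq: "(\<Sum>k=1..m. (real k * fst z + snd z)\<^sup>2) = \<dots>" .
  show ?thesis
    unfolding covar_def sum_eq q_def[symmetric] using \<open>q > 0\<close>
    by (simp add: field_simps power2_eq_square)
qed

section \<open>Passage to the limit under the integral\<close>

lemma scaled_integral_tendsto:
  assumes "m \<ge> 2"
  shows "(\<lambda>n. real n * (\<integral>z. indicator square z * phi m z ^ n \<partial>lborel)) \<longlonglongrightarrow> (\<integral>z. exp (- covar m z / 2) \<partial>lborel)"
proof -
  define c where "c = 1 / (252 * (2 * real m + 1))"
  have "c > 0" by (simp add: c_def)
  define g where "g = (\<lambda>n z. indicator square ((1 / sqrt (real n)) *\<^sub>R z) * phi m ((1 / sqrt (real n)) *\<^sub>R z) ^ n)"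
  \<comment> \<open>The dominating Gaussian is written as a product, with \<open>- 0\<close> kept,
    to match the one-dimensional integral with \<open>a = 2 * c\<close> and
    \<open>b = 0\<close>.\<close>
  let ?w = "\<lambda>z::real \<times> real. exp (- (2 * c) * (fst z - 0)\<^sup>2 / 2) * exp (- (2 * c) * (snd z - 0)\<^sup>2 / 2)"
  have g_meas [measurable]: "g n \<in> borel_measurable borel" for n
    unfolding g_def by measurable
  \<comment> \<open>The index starts at 1 because division by zero makes \<open>g 0\<close>
    constantly 1, which no integrable function dominates.\<close>
  have "(\<lambda>n. \<integral>z. g (Suc n) z \<partial>lborel) \<longlonglongrightarrow> (\<integral>z. exp (- covar m z / 2) \<partial>lborel)"
  proof (rule integral_dominated_convergence)
    show "(\<lambda>z. exp (- covar m z / 2)) \<in> borel_measurable lborel"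
      by measurable
    show "g (Suc n) \<in> borel_measurable lborel" for n by simp
    show "integrable lborel ?w"
      using has_bochner_integral_gaussian[of "2 * c" 0] \<open>c > 0\<close>
      by (intro integrable_lborel_mult_prod) (auto simp: has_bochner_integral_iff)
    show "AE z in lborel. (\<lambda>n. g (Suc n) z) \<longlonglongrightarrow> exp (- covar m z / 2)"
    proof (rule AE_I2)
      fix z :: "real \<times> real"
      have "(\<lambda>n. \<bar>x / sqrt (real n)\<bar>) \<longlonglongrightarrow> 0" for x :: real
        by (rule tendsto_rabs_zero) real_asymp
      then have ev: "eventually (\<lambda>n. \<bar>x / sqrt (real n)\<bar> < pi) sequentially" for x :: real
        by (rule order_tendstoD) simp
      \<comment> \<open>For fixed \<open>z\<close> the rescaled point eventually lies in the square,
        so the indicator disappears.\<close>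
      have "eventually (\<lambda>n. phi m ((1 / sqrt (real n)) *\<^sub>R z) ^ n = g n z) sequentially"
        using ev[of "fst z"] ev[of "snd z"]
      proof eventually_elim
        case (elim n)
        then have "(1 / sqrt (real n)) *\<^sub>R z \<in> square"
          by (simp add: square_def mem_Times_iff abs_less_iff del: abs_divide)
        then show ?case by (simp add: g_def)
      qed
      then have "(\<lambda>n. g n z) \<longlonglongrightarrow> exp (- covar m z / 2)"
        by (rule Lim_transform_eventually[OF phi_power_tendsto])
      then show "(\<lambda>n. g (Suc n) z) \<longlonglongrightarrow> exp (- covar m z / 2)"
        by (rule LIMSEQ_Suc)
    qed
    show "AE z in lborel. norm (g (Suc n) z) \<le> ?w z" for n
    proof (rule AE_I2)
      fix z :: "real \<times> real"
      define N where "N = Suc n"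
      have "N > 0" by (simp add: N_def)
      define y where "y = (1 / sqrt (real N)) *\<^sub>R z"
      show "norm (g (Suc n) z) \<le> ?w z"
      proof (cases "y \<in> square")
        case True
        have "norm (g N z) = \<bar>phi m y\<bar> ^ N"
          using True by (simp add: g_def y_def[symmetric] power_abs)
        also have "\<dots> \<le> exp (- ((fst y)\<^sup>2 + (snd y)\<^sup>2) / (252 * (2 * real m + 1))) ^ N"
          using abs_phi_le[OF assms True] by (intro power_mono) auto
        also have "\<dots> = exp (real N * (- c * ((fst y)\<^sup>2 + (snd y)\<^sup>2)))"
          unfolding exp_of_nat_mult by (simp only: c_def times_divide_eq_left mult_minus_left mult_1 minus_divide_left)
        \<comment> \<open>The \<open>N\<close> from the power cancels the \<open>1 / N\<close> from
          rescaling, so the bound is uniform in \<open>N\<close>.\<close>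
        also have "real N * (- c * ((fst y)\<^sup>2 + (snd y)\<^sup>2)) = - c * (fst z)\<^sup>2 - c * (snd z)\<^sup>2"
          using \<open>N > 0\<close> by (simp add: y_def power_divide field_simps)
        also have "exp \<dots> = ?w z"
          by (simp add: exp_add[symmetric])
        finally show ?thesis by (simp add: N_def)
      next
        case False
        then show ?thesis by (simp add: g_def y_def N_def)
      qed
    qed
  qed
  then have "(\<lambda>n. \<integral>z. g n z \<partial>lborel) \<longlonglongrightarrow> (\<integral>z. exp (- covar m z / 2) \<partial>lborel)"
    by (rule LIMSEQ_imp_Suc)
  moreover have "eventually (\<lambda>n. (\<integral>z. g n z \<partial>lborel) = real n * (\<integral>z. indicator square z * phi m z ^ n \<partial>lborel)) sequentially"
    using eventually_gt_at_top[of 0]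
  proof eventually_elim
    case (elim n)
    have "(\<integral>z. indicator square z * phi m z ^ n \<partial>lborel) = (1 / sqrt (real n))\<^sup>2 * (\<integral>z. g n z \<partial>lborel)"
      unfolding g_def using elim
      by (intro integral_lborel_scale2) auto
    then show ?case using elim by (simp add: power_divide)
  qed
  ultimately show ?thesis by (rule Lim_transform_eventually)
qed

section \<open>Evaluation of the constant\<close>

theorem theorem11:
  fixes q :: nat
  assumes "q \<ge> 5" and "odd q"
  shows "(\<lambda>n. real (M_CPB n q)) \<sim>[at_top]
    (\<lambda>n. real q ^ n * (1 / (pi * real n)) *
       sqrt (12 * (real q)\<^sup>2 / (((real q)\<^sup>2 - 1) * (real q - 1) * (real q - 3))))"
proof -
  obtain m where q: "q = 2 * m + 1" using \<open>odd q\<close> by (elim oddE)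
  with \<open>q \<ge> 5\<close> have "m \<ge> 2" by simp
  define r where "r = real q"
  have r: "r \<ge> 5" "r = 2 * real m + 1" using \<open>q \<ge> 5\<close> by (auto simp: r_def q)
  have "1 < r\<^sup>2" using r(1) by (simp add: one_less_power)
  \<comment> \<open>The determinant of the covariance form. Its factor \<open>r - 3\<close> arises
    as \<open>4 * r - 3 * (r + 1)\<close>, so \<open>r \<ge> 5\<close> makes it positive.\<close>
  define D where "D = (r\<^sup>2 - 1) / 12 * ((r - 1) / r) - ((r\<^sup>2 - 1) / (4 * r))\<^sup>2"
  have D: "D = (r\<^sup>2 - 1) * (r - 1) * (r - 3) / (48 * r\<^sup>2)"
    using r(1) unfolding D_def by (simp add: field_simps power2_eq_square)
  have "D > 0" unfolding D using r(1) \<open>1 < r\<^sup>2\<close> by (intro divide_pos_pos mult_pos_pos) auto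
  define K where "K = sqrt (12 * r\<^sup>2 / ((r\<^sup>2 - 1) * (r - 1) * (r - 3)))"
  have K: "K = 1 / (2 * sqrt D)"
  proof -
    have "12 * r\<^sup>2 / ((r\<^sup>2 - 1) * (r - 1) * (r - 3)) = 1 / (4 * D)"
      using r(1) unfolding D by simp
    then show ?thesis by (simp add: K_def real_sqrt_divide real_sqrt_mult)
  qed
  have "K > 0" unfolding K using \<open>D > 0\<close> by simp
  have "(\<integral>z. exp (- covar m z / 2) \<partial>lborel) = 2 * pi / sqrt D"
    unfolding covar_eq r(2)[symmetric] D_def
    by (rule integral_gaussian2) (use r(1) \<open>D > 0\<close> in \<open>auto simp: D_def\<close>)
  \<comment> \<open>The Gaussian integral \<open>2 * pi / sqrt D\<close> equals
    \<open>4 * pi * K\<close>; dividing by the \<open>4 * pi\<^sup>2\<close> of Fourier inversion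
    leaves \<open>K / pi\<close>.\<close>
  then have "(\<lambda>n. real n * (\<integral>z. indicator square z * phi m z ^ n \<partial>lborel)) \<longlonglongrightarrow> 4 * pi * K"
    using scaled_integral_tendsto[OF \<open>m \<ge> 2\<close>] by (simp add: K)
  then have "(\<lambda>n. real n * (\<integral>z. indicator square z * phi m z ^ n \<partial>lborel) / (4 * pi * K)) \<longlonglongrightarrow> 4 * pi * K / (4 * pi * K)"
    by (rule tendsto_divide[OF _ tendsto_const]) (use \<open>K > 0\<close> in simp)
  then have lim: "(\<lambda>n. real n * (\<integral>z. indicator square z * phi m z ^ n \<partial>lborel) / (4 * pi * K)) \<longlonglongrightarrow> 1"
    using \<open>K > 0\<close> by simp
  have M: "real (M_CPB n q) = r ^ n * (\<integral>z. indicator square z * phi m z ^ n \<partial>lborel) / (4 * pi\<^sup>2)" for n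
    using M_CPB_eq_integral[of n m] by (simp add: q r_def field_simps)
  have "(\<lambda>n. real (M_CPB n q)) \<sim>[at_top] (\<lambda>n. r ^ n * (1 / (pi * real n)) * K)"
  proof (rule asymp_equivI', rule Lim_transform_eventually[OF lim])
    show "\<forall>\<^sub>F n in sequentially. real n * (\<integral>z. indicator square z * phi m z ^ n \<partial>lborel) / (4 * pi * K)
        = real (M_CPB n q) / (r ^ n * (1 / (pi * real n)) * K)"
      using eventually_gt_at_top[of 0]
      by eventually_elim (use r(1) \<open>K > 0\<close> in \<open>simp add: M field_simps power2_eq_square\<close>)
  qed
  then show ?thesis by (simp only: K_def r_def)
qed

end
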